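(* Let $M$ be a finite set of nonzero integers such that $\{-1,1\}\subseteq M$ and $|M|$ is odd. Then $M$ does not split $\mathbb{Z}_p$ for any prime $p$. In particular, if $1\le k_1\le k_2$ are integers and $k_1+k_2$ is odd, then $[-k_1,k_2]^\ast$ does not split $\mathbb{Z}_p$ for any prime $p$.
   Context: $[a,b]^\ast=\{a,a+1,\ldots,b\}\setminus\{0\}$. For a finite group $G$ (written additively) and a set $M$ of integers, $M$ splits $G$ if there is $S\subseteq G$ such that every nonzero $g\in G$ has a unique representation $g=ms$ with $m\in M$, $s\in S$, while $0$ has no such representation (with $ms$ the $m$-fold sum of $s$ for $m\ge0$ and $-((-m)s)$ for $m<0$). *)

theory Defs
  imports "HOL-Algebra.Elementary_Groups" "HOL-Computational_Algebra.Primes"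
begin

(* HOL-Algebra groups are multiplicative: the integer multiple m s is the power s [^] m
   (for m < 0, the inverse of s [^] (-m)), and the zero element is \<one>.
   Uniqueness is of the pair (m, s), hence a single Ex1 over pairs. *)
definition splits :: "int set \<Rightarrow> ('a, 'b) monoid_scheme \<Rightarrow> bool" where
  "splits M G \<longleftrightarrow> (\<exists>S \<subseteq> carrier G.
     (\<forall>g \<in> carrier G - {\<one>\<^bsub>G\<^esub>}. \<exists>!ms. ms \<in> M \<times> S \<and> g = snd ms [^]\<^bsub>G\<^esub> fst ms) \<and>
     \<not> (\<exists>m \<in> M. \<exists>s \<in> S. \<one>\<^bsub>G\<^esub> = s [^]\<^bsub>G\<^esub> m))"

definition punctured_interval :: "int \<Rightarrow> int \<Rightarrow> int set" where
  "punctured_interval a b = {a..b} - {0}"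

end

theory Submission
  imports Defs "HOL-Number_Theory.Cong"
begin

text \<open>
  A splitting of \<open>\<int>\<^sub>p\<close> is a factorization of its multiplicative group into \<open>M\<close> and \<open>S\<close>. For fixed
  \<open>g\<close> there are exactly \<open>card M\<close> triples with \<open>a * m * s = g\<close>, an odd number, and swapping \<open>a\<close> and
  \<open>m\<close> is an involution on them. Its fixed points show that \<open>g = m\<^sup>2 * s\<close> is solvable for every
  \<open>g\<close>, so by counting the solution is unique. This is impossible when \<open>M\<close> contains both \<open>1\<close> and \<open>-1\<close>.
\<close>

text \<open>Swapping the first two entries matches the triples with \<open>a < m\<close> to those
  with \<open>m < a\<close>, so the off-diagonal triples are even in number. The linear order serves
  to pick one triple from each swapped pair.\<close>

lemma odd_card_diagonal:
  fixes T :: "('a::linorder \<times> 'a \<times> 'b) set"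
  assumes "finite T" and "odd (card T)"
    and swap: "\<And>a m s. (a, m, s) \<in> T \<Longrightarrow> (m, a, s) \<in> T"
  obtains m s where "(m, m, s) \<in> T"
proof -
  define L where "L = {(a, m, s) \<in> T. a < m}"
  define U where "U = {(a, m, s) \<in> T. m < a}"
  have "bij_betw (\<lambda>(a, m, s). (m, a, s)) L U"
    by (rule bij_betw_byWitness[where f' = "\<lambda>(a, m, s). (m, a, s)"]) (auto simp: L_def U_def swap)
  then have "card L = card U" by (rule bij_betw_same_card)
  moreover have "finite L" "finite U"
    using \<open>finite T\<close> by (auto simp: L_def U_def intro: finite_subset)
  moreover have "L \<inter> U = {}" by (auto simp: L_def U_def)
  ultimately have "even (card (L \<union> U))" by (simp add: card_Un_disjoint)
  moreover have "T = L \<union> U" if "\<And>m s. (m, m, s) \<notin> T"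
    using that by (auto simp: L_def U_def) (metis linorder_neqE)
  ultimately show thesis
    using that \<open>odd (card T)\<close> by metis
qed

text \<open>Each \<open>a\<close> in \<open>M\<close> is a unit modulo \<open>p\<close>, so it
  extends to exactly one triple \<open>(a, m, s)\<close> with product \<open>g\<close>: the pair
  \<open>(m, s)\<close> has to represent the quotient of \<open>g\<close> by \<open>a\<close>. This
  makes the number of triples odd.\<close>

lemma bij_betw_square_mult_mod:
  fixes M S :: "int set" and p :: nat
  assumes "prime p" and "finite M" and "odd (card M)"
    and bij: "bij_betw (\<lambda>(m, s). m * s mod int p) (M \<times> S) {1..<int p}"
  shows "bij_betw (\<lambda>(m, s). m\<^sup>2 * s mod int p) (M \<times> S) {1..<int p}"
proof -
  let ?R = "{1..<int p}"
  let ?f = "\<lambda>(m, s). m * s mod int p" and ?h = "\<lambda>(m, s). m\<^sup>2 * s mod int p"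
  have prime: "prime (int p)" using \<open>prime p\<close> by simp
  then have "1 < int p" using prime_gt_1_int by blast
  have mod_R: "x mod int p \<in> ?R \<longleftrightarrow> \<not> int p dvd x" for x
  proof -
    have "x mod int p < int p" "0 \<le> x mod int p" using \<open>1 < int p\<close> by auto
    then show ?thesis by (auto simp: dvd_eq_mod_eq_0)
  qed
  have ndvd: "\<not> int p dvd m * s" if "m \<in> M" "s \<in> S" for m s
    using bij_betwE[OF bij] that mod_R by fastforce
  \<comment> \<open>The residue 1 lies in \<open>?R\<close>, hence has a preimage. One element
    \<open>s0\<close> is enough to carry non-divisibility from the products \<open>m * s\<close>
    over to \<open>m\<close> itself.\<close>
  have "M \<times> S \<noteq> {}" using bij \<open>1 < int p\<close> by (auto simp: bij_betw_def)
  then obtain s0 where "s0 \<in> S" by auto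
  have ndvd_M: "\<not> int p dvd m" if "m \<in> M" for m
    using ndvd[OF that \<open>s0 \<in> S\<close>] by auto
  have finite: "finite (M \<times> S)" using bij bij_betw_finite by blast
  have maps: "m\<^sup>2 * s mod int p \<in> ?R" if "m \<in> M" "s \<in> S" for m s
  proof -
    have "\<not> int p dvd m\<^sup>2 * s"
      using that ndvd ndvd_M prime by (simp add: power2_eq_square mult.assoc prime_dvd_mult_iff)
    then show ?thesis using mod_R by simp
  qed
  have "g \<in> ?h ` (M \<times> S)" if "g \<in> ?R" for g
  proof -
    define T where "T = {(a, m, s). a \<in> M \<and> m \<in> M \<and> s \<in> S \<and> a * m * s mod int p = g}"
    have "T \<subseteq> M \<times> (M \<times> S)" by (auto simp: T_def)
    then have "finite T" using finite \<open>finite M\<close> finite_subset by blast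
    have g: "g mod int p = g" "\<not> int p dvd g" using that mod_R[of g] by auto
    have "bij_betw fst T M"
    proof (rule bij_betw_imageI)
      show "inj_on fst T"
      proof (rule inj_onI)
        fix t t' assume "t \<in> T" "t' \<in> T" "fst t = fst t'"
        then obtain a m s m' s' where t: "t = (a, m, s)" "t' = (a, m', s')"
          and mem: "a \<in> M" "m \<in> M" "s \<in> S" "m' \<in> M" "s' \<in> S"
          and "a * m * s mod int p = g" "a * m' * s' mod int p = g"
          by (auto simp: T_def)
        then have "[a * (m * s) = a * (m' * s')] (mod int p)"
          by (simp add: cong_def mult.assoc)
        moreover have "coprime a (int p)"
          using prime ndvd_M[OF mem(1)] by (metis coprime_commute prime_imp_coprime)
        ultimately have "[m * s = m' * s'] (mod int p)"
          using cong_mult_lcancel by blast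
        then have "?f (m, s) = ?f (m', s')" by (simp add: cong_def)
        then have "(m, s) = (m', s')"
          using bij_betw_imp_inj_on[OF bij] mem by (meson SigmaI inj_onD)
        then show "t = t'" using t by simp
      qed
      show "fst ` T = M"
      proof
        show "fst ` T \<subseteq> M" by (auto simp: T_def)
        show "M \<subseteq> fst ` T"
        proof
          fix a assume "a \<in> M"
          then have "coprime a (int p)"
            using prime ndvd_M by (metis coprime_commute prime_imp_coprime)
          \<comment> \<open>\<open>b\<close> inverts \<open>a\<close> modulo \<open>p\<close>, so
            the pair representing \<open>b * g\<close> completes \<open>a\<close> to a triple in
            \<open>T\<close>.\<close>
          then obtain b where b: "[a * b = 1] (mod int p)"
            using cong_solve_coprime_int by blast
          have ab: "[a * (b * g) = g] (mod int p)"
            using cong_scalar_right[OF b, of g] by (simp add: mult.assoc)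
          then have "\<not> int p dvd b * g" using g
            by (metis cong_dvd_iff dvd_mult)
          then have "b * g mod int p \<in> ?f ` (M \<times> S)"
            using mod_R bij by (simp add: bij_betw_def)
          then obtain m s where ms: "m \<in> M" "s \<in> S" "[b * g = m * s] (mod int p)"
            by (auto simp: cong_def)
          then have "[a * (m * s) = g] (mod int p)"
            using ab by (meson cong_scalar_left cong_sym cong_trans)
          then have "(a, m, s) \<in> T"
            using \<open>a \<in> M\<close> ms g by (simp add: T_def cong_def mult.assoc)
          then show "a \<in> fst ` T" by force
        qed
      qed
    qed
    then have "odd (card T)" using \<open>odd (card M)\<close> bij_betw_same_card by metis
    moreover have "(m, a, s) \<in> T" if "(a, m, s) \<in> T" for a m s
      using that by (simp add: T_def mult.commute)
    ultimately obtain m s where "(m, m, s) \<in> T"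
      using odd_card_diagonal \<open>finite T\<close> by blast
    then show ?thesis by (force simp: T_def power2_eq_square)
  qed
  then have image: "?h ` (M \<times> S) = ?R" using maps by auto
  \<comment> \<open>By \<open>bij\<close>, the finite domain has as many elements as
    \<open>?R\<close>, so surjectivity forces injectivity.\<close>
  moreover have "inj_on ?h (M \<times> S)"
    using image finite bij_betw_same_card[OF bij] by (metis eq_card_imp_inj_on)
  ultimately show ?thesis by (simp add: bij_betw_def)
qed

lemma not_splits_odd_card:
  fixes M :: "int set" and p :: nat
  assumes "prime p" and "finite M" and "{-1, 1} \<subseteq> M" and "odd (card M)"
  shows "\<not> splits M (integer_mod_group p)"
proof
  have p: "1 < int p" using \<open>prime p\<close> prime_gt_1_nat by simp
  have carrier: "carrier (integer_mod_group p) = {0..<int p}"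
    using p by (simp add: carrier_integer_mod_group)
  assume "splits M (integer_mod_group p)"
  then obtain S where S: "S \<subseteq> {0..<int p}"
    and uniq: "\<And>g. g \<in> {0..<int p} - {0} \<Longrightarrow>
      \<exists>!ms. ms \<in> M \<times> S \<and> g = fst ms * snd ms mod int p"
    and nonzero: "\<And>m s. m \<in> M \<Longrightarrow> s \<in> S \<Longrightarrow> m * s mod int p \<noteq> 0"
    unfolding splits_def carrier by (auto simp: int_pow_integer_mod_group mult.commute)
  have range: "m * s mod int p \<in> {1..<int p}" if "m \<in> M" "s \<in> S" for m s
  proof -
    have "m * s mod int p < int p" "0 \<le> m * s mod int p" using p by auto
    then show ?thesis using nonzero[OF that] by auto
  qed
  have "bij_betw (\<lambda>(m, s). m * s mod int p) (M \<times> S) {1..<int p}"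
  proof (rule bij_betw_imageI)
    show "inj_on (\<lambda>(m, s). m * s mod int p) (M \<times> S)"
    proof (rule inj_onI)
      fix x y
      assume xy: "x \<in> M \<times> S" "y \<in> M \<times> S"
        "(case x of (m, s) \<Rightarrow> m * s mod int p) = (case y of (m, s) \<Rightarrow> m * s mod int p)"
      \<comment> \<open>Uniqueness is granted only for nonzero elements; \<open>range\<close> places
        the common value of \<open>x\<close> and \<open>y\<close> among them.\<close>
      have "fst x * snd x mod int p \<in> {0..<int p} - {0}"
        using range xy(1) by fastforce
      from uniq[OF this] xy show "x = y"
        by (simp only: case_prod_unfold) (elim ex1E, metis)
    qed
    show "(\<lambda>(m, s). m * s mod int p) ` (M \<times> S) = {1..<int p}"
    proof
      show "(\<lambda>(m, s). m * s mod int p) ` (M \<times> S) \<subseteq> {1..<int p}" using range by auto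
      show "{1..<int p} \<subseteq> (\<lambda>(m, s). m * s mod int p) ` (M \<times> S)"
      proof
        fix g assume "g \<in> {1..<int p}"
        then have "g \<in> {0..<int p} - {0}" by auto
        from ex1_implies_ex[OF uniq[OF this]]
        show "g \<in> (\<lambda>(m, s). m * s mod int p) ` (M \<times> S)" by auto
      qed
    qed
  qed
  then have bij: "bij_betw (\<lambda>(m, s). m\<^sup>2 * s mod int p) (M \<times> S) {1..<int p}"
    using bij_betw_square_mult_mod assms by blast
  then have "M \<times> S \<noteq> {}" using p by (auto simp: bij_betw_def)
  then obtain s where "s \<in> S" by auto
  \<comment> \<open>Squaring erases the sign, so both pairs have the image
    \<open>s mod int p\<close>. They differ as pairs of integers even for \<open>p = 2\<close>,
    where 1 and -1 are congruent.\<close>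
  then have "(1, s) \<in> M \<times> S" "(-1, s) \<in> M \<times> S" using \<open>{-1, 1} \<subseteq> M\<close> by auto
  then have "(1, s) = (-1 :: int, s)"
    using inj_onD[OF bij_betw_imp_inj_on[OF bij], of "(1, s)" "(-1, s)"] by simp
  then show False by simp
qed

theorem theorem3p5:
  shows "(\<forall>M :: int set. finite M \<and> 0 \<notin> M \<and> {-1, 1} \<subseteq> M \<and> odd (card M) \<longrightarrow>
            (\<forall>p :: nat. prime p \<longrightarrow> \<not> splits M (integer_mod_group p))) \<and>
         (\<forall>k1 k2 :: int. 1 \<le> k1 \<and> k1 \<le> k2 \<and> odd (k1 + k2) \<longrightarrow>
            (\<forall>p :: nat. prime p \<longrightarrow> \<not> splits (punctured_interval (- k1) k2) (integer_mod_group p)))"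
proof (intro conjI allI impI)
  fix M :: "int set" and p :: nat
  assume "finite M \<and> 0 \<notin> M \<and> {-1, 1} \<subseteq> M \<and> odd (card M)" "prime p"
  then show "\<not> splits M (integer_mod_group p)" using not_splits_odd_card by blast
next
  fix k1 k2 :: int and p :: nat
  assume k: "1 \<le> k1 \<and> k1 \<le> k2 \<and> odd (k1 + k2)" and "prime p"
  \<comment> \<open>The full interval has \<open>k1 + k2 + 1\<close> elements, and 0 is one of
    them.\<close>
  then have "int (card (punctured_interval (- k1) k2)) = k1 + k2"
    by (simp add: punctured_interval_def, linarith)
  then have "odd (card (punctured_interval (- k1) k2))"
    using k by (metis even_of_nat)
  moreover have "finite (punctured_interval (- k1) k2)" "{-1, 1} \<subseteq> punctured_interval (- k1) k2"
    using k by (auto simp: punctured_interval_def)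
  ultimately show "\<not> splits (punctured_interval (- k1) k2) (integer_mod_group p)"
    using not_splits_odd_card \<open>prime p\<close> by blast
qed

end
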